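(* Let $\Sigma=\{0,1\}$. For every $X\in\Sigma^\infty$, $$H^{disjoint}(X)=\dim_{\mathrm{FS}}^{\mathrm{multi-bet}}(X),$$ i.e. the disjoint block entropy rate of $X$ equals the multi-bet finite state dimension of $X$.
   Context: $\Sigma=\{0,1\}$; $X\restriction n$ is the string of the first $n$ symbols of $X\in\Sigma^\infty$; for a string $x$, $x[a:b]$ is the substring from index $a$ to index $b-1$ (indices start at $0$); $\lambda$ is the empty string; $\log$ is base 2 and $0\log0=0$. Multi-bet finite state dimension. For an integer $k\ge1$, a $k$-bet finite-state gambler is a tuple $G=(Q,\delta,\vec\beta,q_0,c_0)$ with $Q$ a nonempty finite set of states, $\delta:Q\times\{0,1\}\to Q$ the transition function, $\vec\beta=(\beta_1,\dots,\beta_k):Q\to(\mathbb{Q}\cap[0,1])^k$ the betting function, $q_0\in Q$ the initial state, and $c_0$ a nonnegative rational (initial capital). For $w\in\{0,1\}^*$ write $\beta_i(w)$ for $\beta_i$ evaluated at the state reached from $q_0$ after reading $w$. For $s\in[0,\infty)$ the induced $s$-product-gale ($k$-bet finite state $s$-gale) $d_G^s:\{0,1\}^*\to[0,\infty)$ is given by $d_G^s(\lambda)=c_0$ and, for $b\in\{0,1\}$, $d_G^s(wb)=d_G^s(w)\prod_{i=1}^k 2^s\left[(1-b)(1-\beta_i(w))+b\,\beta_i(w)\right]$. It succeeds on $X$ if $\limsup_{n\to\infty}d_G^s(X\restriction n)=\infty$. Let $\mathcal{G}_{FS}^{\mathrm{multi-bet}}(X)$ be the set of $s\in[0,1]$ for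 which there exist $k\ge1$ and a $k$-bet finite-state gambler $G$ such that $d_G^s$ succeeds on $X$, and $\dim_{\mathrm{FS}}^{\mathrm{multi-bet}}(X)=\inf\mathcal{G}_{FS}^{\mathrm{multi-bet}}(X)$, the infimum being taken in $[0,1]$ (so $\inf\emptyset=1$). Disjoint block entropy rate. For $\ell,k\ge1$, $x\in\Sigma^{\ell k}$ and $u\in\Sigma^\ell$ let $N(u,x)=|\{0\le i<k: x[i\ell:(i+1)\ell]=u\}|$ and $P(u,x)=N(u,x)/k$. Let $H_\ell^{disjoint}(x)=-\frac{1}{\ell\log|\Sigma|}\sum_{u\in\Sigma^\ell}P(u,x)\log P(u,x)$, $H_\ell^{disjoint}(X)=\liminf_{k\to\infty}H_\ell^{disjoint}(X\restriction k\ell)$ and $H^{disjoint}(X)=\inf_{\ell\ge1}H_\ell^{disjoint}(X)$. *)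

theory Defs
  imports "HOL-Analysis.Analysis"
begin

section \<open>Binary strings and sequences\<close>

text \<open>
  The alphabet is \<^typ>\<open>bool\<close>, with \<^const>\<open>False\<close> as the symbol 0 and \<^const>\<open>True\<close> as the symbol 1.
\<close>

definition seq_prefix :: "(nat \<Rightarrow> bool) \<Rightarrow> nat \<Rightarrow> bool list" where
  "seq_prefix X n = map X [0..<n]"

definition substring :: "bool list \<Rightarrow> nat \<Rightarrow> nat \<Rightarrow> bool list" where
  "substring x a b = take (b - a) (drop a x)"

section \<open>Multi-bet finite-state gamblers\<close>

text \<open>
  The number of bets is not a field of the gambler: a \<open>k\<close>-bet gambler uses the bets
  with indices in \<open>{1..k}\<close>, and the others are irrelevant, as are the values of all
  functions outside \<open>states\<close>.
\<close>

record 'q gambler =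
  states  :: "'q set"
  trans   :: "'q \<Rightarrow> bool \<Rightarrow> 'q"
  bet     :: "'q \<Rightarrow> nat \<Rightarrow> rat"
  start   :: 'q
  capital :: rat

definition multi_bet_gambler :: "nat \<Rightarrow> 'q gambler \<Rightarrow> bool" where
  "multi_bet_gambler k G \<longleftrightarrow>
     k \<ge> 1 \<and>
     finite (states G) \<and> states G \<noteq> {} \<and>
     (\<forall>q\<in>states G. \<forall>b. trans G q b \<in> states G) \<and>
     (\<forall>q\<in>states G. \<forall>i\<in>{1..k}. 0 \<le> bet G q i \<and> bet G q i \<le> 1) \<and>
     start G \<in> states G \<and>
     0 \<le> capital G"

definition state_after :: "'q gambler \<Rightarrow> bool list \<Rightarrow> 'q" where
  "state_after G w = foldl (trans G) (start G) w"

definition bet_after :: "'q gambler \<Rightarrow> nat \<Rightarrow> bool list \<Rightarrow> real" where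
  "bet_after G i w = of_rat (bet G (state_after G w) i)"

function product_gale :: "nat \<Rightarrow> real \<Rightarrow> 'q gambler \<Rightarrow> bool list \<Rightarrow> real" where
  "product_gale k s G w =
     (if w = [] then of_rat (capital G)
      else product_gale k s G (butlast w) *
        (\<Prod>i\<in>{1..k}. 2 powr s *
           ((1 - of_bool (last w)) * (1 - bet_after G i (butlast w))
            + of_bool (last w) * bet_after G i (butlast w))))"
  by pat_completeness auto
termination
  by (relation "Wellfounded.measure (\<lambda>(k, s, G, w). length w)") auto

declare product_gale.simps [simp del]

lemma product_gale_Nil: "product_gale k s G [] = of_rat (capital G)"
  by (simp add: product_gale.simps)

lemma product_gale_snoc:
  "product_gale k s G (w @ [b]) =
     product_gale k s G w *
       (\<Prod>i\<in>{1..k}. 2 powr s *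
          ((1 - of_bool b) * (1 - bet_after G i w) + of_bool b * bet_after G i w))"
  by (subst product_gale.simps) simp

definition gale_succeeds :: "nat \<Rightarrow> real \<Rightarrow> 'q gambler \<Rightarrow> (nat \<Rightarrow> bool) \<Rightarrow> bool" where
  "gale_succeeds k s G X \<longleftrightarrow>
     limsup (\<lambda>n. ereal (product_gale k s G (seq_prefix X n))) = \<infinity>"

text \<open>
  A type cannot be quantified existentially, so the states are drawn from \<^typ>\<open>nat\<close>.
  By the following lemma this loses no gambler: every finite-state gambler, over any
  type of states, has the same gale as one whose states are natural numbers.
\<close>

lemma nat_states_suffice:
  fixes G :: "'q gambler"
  assumes "multi_bet_gambler k G"
  shows "\<exists>G' :: nat gambler. multi_bet_gambler k G' \<and>
           (\<forall>s w. product_gale k s G' w = product_gale k s G w)"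
proof -
  have fin: "finite (states G)"
    using assms by (simp add: multi_bet_gambler_def)
  obtain f :: "'q \<Rightarrow> nat" where f: "inj_on f (states G)"
    using finite_imp_inj_to_nat_seg[OF fin] by blast
  define g where "g = inv_into (states G) f"
  have g: "g (f q) = q" if "q \<in> states G" for q
    using f that by (simp add: g_def)
  define G' :: "nat gambler" where
    "G' = \<lparr>states = f ` states G, trans = (\<lambda>q b. f (trans G (g q) b)),
          bet = (\<lambda>q. bet G (g q)), start = f (start G), capital = capital G\<rparr>"
  have gam: "multi_bet_gambler k G'"
    using assms g by (auto simp: multi_bet_gambler_def G'_def)
  have state: "state_after G w \<in> states G \<and> state_after G' w = f (state_after G w)" for w
  proof (induction w rule: rev_induct)
    case Nil
    then show ?case
      using assms by (simp add: state_after_def G'_def multi_bet_gambler_def)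
  next
    case (snoc b w)
    then show ?case
      using assms g by (simp add: state_after_def G'_def multi_bet_gambler_def)
  qed
  have "bet G' (f q) = bet G q" if "q \<in> states G" for q
    using g that by (simp add: G'_def)
  then have bets: "bet_after G' i w = bet_after G i w" for i w
    using state[of w] by (simp add: bet_after_def)
  have "product_gale k s G' w = product_gale k s G w" for s w
  proof (induction w rule: rev_induct)
    case Nil
    then show ?case
      by (simp add: product_gale_Nil G'_def)
  next
    case (snoc b w)
    then show ?case
      by (simp add: product_gale_snoc bets)
  qed
  with gam show ?thesis
    by blast
qed

definition multi_bet_rates :: "(nat \<Rightarrow> bool) \<Rightarrow> real set" where
  "multi_bet_rates X =
     {s. 0 \<le> s \<and> s \<le> 1 \<and>
         (\<exists>k\<ge>1. \<exists>G :: nat gambler. multi_bet_gambler k G \<and> gale_succeeds k s G X)}"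

text \<open>The infimum is that of the ordered set \<open>[0,1]\<close>, where the empty set has infimum 1.\<close>

definition multi_bet_dim :: "(nat \<Rightarrow> bool) \<Rightarrow> real" where
  "multi_bet_dim X = (if multi_bet_rates X = {} then 1 else Inf (multi_bet_rates X))"

section \<open>Disjoint block entropy rate\<close>

text \<open>
  In the next two definitions, \<^term>\<open>length x div length u\<close> is the number of blocks of
  \<open>x\<close> of the length of \<open>u\<close>; they are used only when \<open>length u\<close> is positive and divides
  \<open>length x\<close>.
\<close>

definition block_count :: "bool list \<Rightarrow> bool list \<Rightarrow> nat" where
  "block_count u x =
     card {i. i < length x div length u \<and>
              substring x (i * length u) ((i + 1) * length u) = u}"

definition block_freq :: "bool list \<Rightarrow> bool list \<Rightarrow> real" where
  "block_freq u x = real (block_count u x) / real (length x div length u)"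

text \<open>The convention \<open>0 log 0 = 0\<close> holds because multiplication by 0 always gives 0.\<close>

definition disjoint_block_entropy :: "nat \<Rightarrow> bool list \<Rightarrow> real" where
  "disjoint_block_entropy l x =
     - (1 / (real l * log 2 (real CARD(bool)))) *
       (\<Sum>u | length u = l. block_freq u x * log 2 (block_freq u x))"

definition disjoint_entropy_rate_at :: "nat \<Rightarrow> (nat \<Rightarrow> bool) \<Rightarrow> ereal" where
  "disjoint_entropy_rate_at l X =
     liminf (\<lambda>k. ereal (disjoint_block_entropy l (seq_prefix X (k * l))))"

definition disjoint_entropy_rate :: "(nat \<Rightarrow> bool) \<Rightarrow> ereal" where
  "disjoint_entropy_rate X = (INF l\<in>{1..}. disjoint_entropy_rate_at l X)"

end

theory Submission
  imports Defs "HOL-Real_Asymp.Real_Asymp"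
begin

text \<open>
  The logarithm of a multi-bet gale is, up to a constant, \<open>k n s\<close> minus the sum of the
  log-losses of its \<open>k\<close> bettors. Started in a fixed state, a bettor defines a probability
  measure on blocks of length \<open>l\<close>, so by Gibbs' inequality its loss on the first \<open>m\<close> blocks
  is at least \<open>m l\<close> times the block entropy, up to \<open>m log |Q|\<close> for the unknown state at the
  beginning of each block; this error vanishes as \<open>l\<close> grows. Conversely, a single bettor
  that bets on blocks of length \<open>l\<close> according to a fixed distribution close to the empirical
  one has loss close to the block entropy. There are only finitely many distributions on a
  fine grid, so one of them is close to the empirical one infinitely often.
\<close>

section \<open>Blocks and their frequencies\<close>

definition block :: "(nat \<Rightarrow> bool) \<Rightarrow> nat \<Rightarrow> nat \<Rightarrow> bool list" where
  "block X l i = map X [i * l..<i * l + l]"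

text \<open>Frequencies are read off the sequence and not off a prefix, so that sums can range over
  block indices. For \<open>k = 0\<close> the division gives 0, and the frequencies then do not sum
  to 1.\<close>

definition freq :: "(nat \<Rightarrow> bool) \<Rightarrow> nat \<Rightarrow> nat \<Rightarrow> bool list \<Rightarrow> real" where
  "freq X l k u = real (card {i. i < k \<and> block X l i = u}) / real k"

lemma length_block [simp]: "length (block X l i) = l"
  by (simp add: block_def)

lemma seq_prefix_add: "seq_prefix X (m + n) = seq_prefix X m @ map X [m..<m + n]"
  by (simp add: seq_prefix_def upt_add_eq_append[of 0 m n])

lemma seq_prefix_Suc_blocks: "seq_prefix X (Suc k * l) = seq_prefix X (k * l) @ block X l k"
  using seq_prefix_add[of X "k * l" l] by (simp add: block_def add.commute)

lemma finite_length_eq: "finite {u :: bool list. length u = l}"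
  using finite_lists_length_eq[of "UNIV :: bool set" l] by simp

lemma card_length_eq: "card {u :: bool list. length u = l} = 2 ^ l"
  using card_lists_length_eq[of "UNIV :: bool set" l] by simp

lemma sum_length_pos:
  fixes f :: "bool list \<Rightarrow> nat"
  assumes "\<And>u. f u > 0"
  shows "(\<Sum>u | length u = l. f u) > 0"
proof (rule sum_pos)
  have "replicate l True \<in> {u. length u = l}"
    by simp
  then show "{u :: bool list. length u = l} \<noteq> {}"
    by blast
qed (use assms finite_length_eq in auto)

lemma sum_length_Suc:
  fixes f :: "bool list \<Rightarrow> 'b :: comm_monoid_add"
  shows "(\<Sum>u | length u = Suc l. f u) = (\<Sum>u | length u = l. f (True # u) + f (False # u))"
proof -
  have "{u :: bool list. length u = Suc l} =
      Cons True ` {u. length u = l} \<union> Cons False ` {u. length u = l}"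
    by (auto simp: length_Suc_conv)
  then have "(\<Sum>u | length u = Suc l. f u) =
      (\<Sum>u\<in>Cons True ` {u. length u = l}. f u) + (\<Sum>u\<in>Cons False ` {u. length u = l}. f u)"
    by (simp only:) (rule sum.union_disjoint; auto simp: finite_length_eq)
  also have "\<dots> = (\<Sum>u | length u = l. f (True # u)) + (\<Sum>u | length u = l. f (False # u))"
    by (simp add: sum.reindex)
  finally show ?thesis
    by (simp add: sum.distrib)
qed

lemma block_freq_seq_prefix:
  assumes "l \<ge> 1" "length u = l"
  shows "block_freq u (seq_prefix X (k * l)) = freq X l k u"
proof -
  have "substring (seq_prefix X (k * l)) (i * l) ((i + 1) * l) = block X l i" if "i < k" for i
  proof -
    have "Suc i * l \<le> k * l"
      using that by (intro mult_le_mono1) simp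
    then show ?thesis
      by (simp add: substring_def seq_prefix_def block_def drop_map take_map add.commute)
  qed
  then have "{i. i < k \<and> substring (seq_prefix X (k * l)) (i * l) ((i + 1) * l) = u} =
      {i. i < k \<and> block X l i = u}"
    by auto
  moreover have "length (seq_prefix X (k * l)) div l = k"
    using assms by (simp add: seq_prefix_def)
  ultimately show ?thesis
    using assms by (simp add: block_freq_def block_count_def freq_def)
qed

lemma disjoint_block_entropy_seq_prefix:
  assumes "l \<ge> 1"
  shows "real l * disjoint_block_entropy l (seq_prefix X (k * l)) =
    - (\<Sum>u | length u = l. freq X l k u * log 2 (freq X l k u))"
  using assms by (simp add: disjoint_block_entropy_def block_freq_seq_prefix)

text \<open>Grouping the indices by the block found there turns a sum over time into an expectation
  under the empirical distribution. This is how log-losses become cross-entropies.\<close>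

lemma sum_blocks:
  assumes "k > 0"
  shows "(\<Sum>j<k. f (block X l j)) = real k * (\<Sum>u | length u = l. freq X l k u * f u)"
proof -
  have "(\<Sum>j<k. f (block X l j)) =
      (\<Sum>u | length u = l. \<Sum>j | j \<in> {..<k} \<and> block X l j = u. f (block X l j))"
    by (rule sum.group[symmetric]) (auto simp: finite_length_eq)
  also have "\<dots> = (\<Sum>u | length u = l. real k * (freq X l k u * f u))"
    using assms by (intro sum.cong) (auto simp: freq_def)
  finally show ?thesis
    by (simp add: sum_distrib_left)
qed

lemma freq_nonneg: "freq X l k u \<ge> 0"
  by (simp add: freq_def)

lemma sum_freq:
  assumes "k > 0"
  shows "(\<Sum>u | length u = l. freq X l k u) = 1"
  using sum_blocks[OF assms, of "\<lambda>_. 1" X l] assms by simp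

lemma freq_le_1:
  assumes "k > 0"
  shows "freq X l k u \<le> 1"
proof -
  have "card {i. i < k \<and> block X l i = u} \<le> card {..<k}"
    by (intro card_mono) auto
  then show ?thesis
    using assms by (simp add: freq_def)
qed

lemma block_of_freq_pos:
  assumes "freq X l k u > 0"
  obtains j where "j < k" "block X l j = u"
proof -
  have "{i. i < k \<and> block X l i = u} \<noteq> {}"
    using assms by (auto simp: freq_def simp del: Collect_empty_eq)
  then show ?thesis
    using that by auto
qed

section \<open>Lower and upper limits\<close>

lemma frequently_less_of_Liminf_less:
  fixes f :: "'a \<Rightarrow> 'b :: complete_linorder"
  assumes "Liminf F f < y"
  shows "\<exists>\<^sub>F x in F. f x < y"
proof (rule ccontr)
  assume "\<not> (\<exists>\<^sub>F x in F. f x < y)"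
  then have "\<forall>\<^sub>F x in F. y \<le> f x"
    by (simp add: not_frequently not_less)
  from Liminf_bounded[OF this] assms show False
    by simp
qed

lemma frequently_greater_of_less_Limsup:
  fixes f :: "'a \<Rightarrow> 'b :: complete_linorder"
  assumes "y < Limsup F f"
  shows "\<exists>\<^sub>F x in F. y < f x"
proof (rule ccontr)
  assume "\<not> (\<exists>\<^sub>F x in F. y < f x)"
  then have "\<forall>\<^sub>F x in F. f x \<le> y"
    by (simp add: not_frequently not_less)
  from Limsup_bounded[OF this] assms show False
    by simp
qed

lemma Liminf_le_of_frequently:
  fixes f :: "'a \<Rightarrow> 'b :: complete_linorder"
  assumes "\<And>y. C < y \<Longrightarrow> \<exists>\<^sub>F x in F. f x < y"
  shows "Liminf F f \<le> C"
proof (rule ccontr)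
  assume "\<not> Liminf F f \<le> C"
  then have less: "C < Liminf F f"
    by simp
  have between: False if "C < y" "y < Liminf F f" for y
    using frequently_ex[OF frequently_eventually_conj[OF assms[OF that(1)] less_LiminfD[OF that(2)]]]
    by auto
  \<comment> \<open>The order is not assumed dense, so a value of \<open>f\<close> itself serves as
    the point between \<open>C\<close> and the lower limit.\<close>
  obtain x where "C < f x" "f x < Liminf F f"
    using frequently_ex[OF frequently_eventually_conj[OF assms[OF less] less_LiminfD[OF less]]]
    by auto
  then show False
    by (rule between)
qed

lemma le_Limsup_of_frequently:
  fixes f :: "'a \<Rightarrow> 'b :: complete_linorder"
  assumes "\<And>y. y < C \<Longrightarrow> \<exists>\<^sub>F x in F. y < f x"
  shows "C \<le> Limsup F f"
proof (rule ccontr)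
  assume "\<not> C \<le> Limsup F f"
  then have less: "Limsup F f < C"
    by simp
  have between: False if "y < C" "Limsup F f < y" for y
    using frequently_ex[OF frequently_eventually_conj[OF assms[OF that(1)] Limsup_lessD[OF that(2)]]]
    by auto
  obtain x where "f x < C" "Limsup F f < f x"
    using frequently_ex[OF frequently_eventually_conj[OF assms[OF less] Limsup_lessD[OF less]]]
    by auto
  then show False
    by (rule between)
qed

section \<open>Gibbs' inequality\<close>

lemma log_prod:
  fixes f :: "'a \<Rightarrow> real"
  assumes "finite I" "\<And>i. i \<in> I \<Longrightarrow> f i \<noteq> 0"
  shows "log b (\<Prod>i\<in>I. f i) = (\<Sum>i\<in>I. log b (f i))"
  using assms by (simp add: log_def ln_prod sum_divide_distrib)

text \<open>The bound \<open>ln x \<le> x - 1\<close> at the ratio of \<open>r u / Z\<close> to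
  \<open>P u\<close>, weighted by \<open>P u\<close> and summed. Positivity of \<open>r\<close>
  where \<open>P\<close> is positive matters: \<open>log 2 0\<close> is 0 here and not minus
  infinity, so a zero weight would otherwise cost nothing.\<close>

lemma gibbs:
  fixes P r :: "'a \<Rightarrow> real"
  assumes "finite U" and P: "\<And>u. u \<in> U \<Longrightarrow> P u \<ge> 0" "(\<Sum>u\<in>U. P u) = 1"
    and r: "\<And>u. u \<in> U \<Longrightarrow> r u \<ge> 0" "\<And>u. u \<in> U \<Longrightarrow> P u > 0 \<Longrightarrow> r u > 0"
    and Z: "(\<Sum>u\<in>U. r u) \<le> Z" "Z > 0"
  shows "(\<Sum>u\<in>U. P u * log 2 (r u)) \<le> log 2 Z + (\<Sum>u\<in>U. P u * log 2 (P u))"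
proof -
  have "P u * ln (r u) - P u * ln Z - P u * ln (P u) \<le> r u / Z - P u" if u: "u \<in> U" for u
  proof (cases "P u = 0")
    case True
    then show ?thesis
      using r(1)[OF u] Z by simp
  next
    case False
    then have pos: "P u > 0" "r u > 0"
      using P(1)[OF u] r(2)[OF u] by auto
    have "ln (r u / (Z * P u)) \<le> r u / (Z * P u) - 1"
      using pos Z by (intro ln_le_minus_one) simp
    then have "P u * ln (r u / (Z * P u)) \<le> P u * (r u / (Z * P u) - 1)"
      using pos by (intro mult_left_mono) auto
    moreover have "ln (r u / (Z * P u)) = ln (r u) - ln Z - ln (P u)"
      using pos Z by (simp add: ln_div ln_mult)
    moreover have "P u * (r u / (Z * P u) - 1) = r u / Z - P u"
      using pos by (simp add: field_simps)
    ultimately show ?thesis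
      by (simp add: algebra_simps)
  qed
  then have "(\<Sum>u\<in>U. P u * ln (r u) - P u * ln Z - P u * ln (P u)) \<le> (\<Sum>u\<in>U. r u / Z - P u)"
    by (rule sum_mono)
  also have "\<dots> \<le> 0"
    using P(2) Z by (simp add: sum_subtractf flip: sum_divide_distrib)
  finally have "(\<Sum>u\<in>U. P u * ln (r u)) \<le> ln Z + (\<Sum>u\<in>U. P u * ln (P u))"
    using P(2) by (simp add: sum_subtractf flip: sum_distrib_right)
  then have "(\<Sum>u\<in>U. P u * ln (r u)) / ln 2 \<le> (ln Z + (\<Sum>u\<in>U. P u * ln (P u))) / ln 2"
    by (intro divide_right_mono) auto
  then show ?thesis
    by (simp add: log_def sum_divide_distrib add_divide_distrib)
qed

text \<open>Gibbs' inequality for the empirical distribution of the first \<open>k\<close> blocks: a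
  weight function of total mass at most \<open>Z\<close> beats the block entropy by at most
  \<open>log 2 Z\<close> per block. A block of positive frequency occurs at some index, which gives
  the positivity that Gibbs' inequality asks for.\<close>

lemma sum_log_blocks_le:
  assumes "k > 0" "l \<ge> 1" and r: "\<And>u. r u \<ge> 0" "\<And>j. j < k \<Longrightarrow> r (block X l j) > 0"
    and Z: "(\<Sum>u | length u = l. r u) \<le> Z" "Z > 0"
  shows "(\<Sum>j<k. log 2 (r (block X l j))) \<le>
    real k * (log 2 Z - real l * disjoint_block_entropy l (seq_prefix X (k * l)))"
proof -
  have "(\<Sum>u | length u = l. freq X l k u * log 2 (r u)) \<le>
      log 2 Z + (\<Sum>u | length u = l. freq X l k u * log 2 (freq X l k u))"
  proof (rule gibbs)
    show "r u > 0" if "freq X l k u > 0" for u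
      using that r(2) by (metis block_of_freq_pos)
  qed (use assms in \<open>auto simp: finite_length_eq freq_nonneg sum_freq\<close>)
  then show ?thesis
    using assms sum_blocks[of k "\<lambda>u. log 2 (r u)" X l]
    by (simp add: disjoint_block_entropy_seq_prefix mult_left_mono)
qed

section \<open>Range of the block entropy\<close>

lemma disjoint_block_entropy_nonneg:
  assumes "l \<ge> 1" "k > 0"
  shows "disjoint_block_entropy l (seq_prefix X (k * l)) \<ge> 0"
proof -
  have "freq X l k u * log 2 (freq X l k u) \<le> 0" for u
    using freq_nonneg[of X l k u] freq_le_1[OF assms(2), of X l u]
    by (cases "freq X l k u = 0") (auto intro!: mult_nonneg_nonpos)
  then have "(\<Sum>u | length u = l. freq X l k u * log 2 (freq X l k u)) \<le> 0"
    by (intro sum_nonpos) auto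
  then have "real l * disjoint_block_entropy l (seq_prefix X (k * l)) \<ge> 0"
    using disjoint_block_entropy_seq_prefix[OF assms(1), of X k] by simp
  then show ?thesis
    using assms by (simp add: zero_le_mult_iff)
qed

lemma disjoint_block_entropy_le_1:
  assumes "l \<ge> 1" "k > 0"
  shows "disjoint_block_entropy l (seq_prefix X (k * l)) \<le> 1"
proof -
  \<comment> \<open>The constant weight 1 has total mass \<open>2 ^ l\<close> and logarithm
    0.\<close>
  have "(\<Sum>j<k. log 2 1) \<le>
      real k * (log 2 (2 ^ l) - real l * disjoint_block_entropy l (seq_prefix X (k * l)))"
    using assms by (intro sum_log_blocks_le) (auto simp: card_length_eq)
  then show ?thesis
    using assms by (simp add: log_nat_power zero_le_mult_iff)
qed

section \<open>The measure defined by a bettor\<close>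

text \<open>The probability that bettor \<open>i\<close> assigns to a string. The initial state is a
  parameter because successive blocks are entered in different states.\<close>

fun run_prob :: "'q gambler \<Rightarrow> nat \<Rightarrow> 'q \<Rightarrow> bool list \<Rightarrow> real" where
  "run_prob G i q [] = 1"
| "run_prob G i q (b # u) =
     (if b then of_rat (bet G q i) else 1 - of_rat (bet G q i)) * run_prob G i (trans G q b) u"

lemma run_prob_append:
  "run_prob G i q (u @ v) = run_prob G i q u * run_prob G i (foldl (trans G) q u) v"
  by (induction u arbitrary: q) auto

text \<open>The factors \<open>2 powr s\<close> separate from the bets, so that the \<open>k\<close>
  bettors can be bounded one at a time.\<close>

lemma product_gale_eq:
  "product_gale k s G w =
    of_rat (capital G) * 2 powr (s * real k * real (length w)) *
    (\<Prod>i\<in>{1..k}. run_prob G i (start G) w)"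
proof (induction w rule: rev_induct)
  case Nil
  then show ?case
    by (simp add: product_gale_Nil)
next
  case (snoc b w)
  define B where "B i = (1 - of_bool b) * (1 - bet_after G i w) + of_bool b * bet_after G i w" for i
  have "run_prob G i (start G) (w @ [b]) = run_prob G i (start G) w * B i" for i
    by (simp add: run_prob_append B_def bet_after_def state_after_def)
  moreover have "2 powr (s * real k * real (length (w @ [b]))) =
      2 powr (s * real k * real (length w)) * (2 powr s) ^ k"
    by (simp add: powr_add powr_powr algebra_simps flip: powr_realpow)
  ultimately show ?case
    by (simp add: product_gale_snoc snoc.IH prod.distrib flip: B_def)
qed

lemma sum_run_prob: "(\<Sum>u | length u = l. run_prob G i q u) = 1"
proof (induction l arbitrary: q)
  case 0
  have "{u :: bool list. length u = 0} = {[]}"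
    by auto
  then show ?case
    by simp
next
  case (Suc l)
  then show ?case
    by (simp add: sum_length_Suc sum.distrib flip: sum_distrib_left)
qed

lemma run_prob_blocks:
  "run_prob G i q (seq_prefix X (k * l)) =
    (\<Prod>j<k. run_prob G i (foldl (trans G) q (seq_prefix X (j * l))) (block X l j))"
proof (induction k)
  case 0
  then show ?case
    by (simp add: seq_prefix_def)
next
  case (Suc k)
  then show ?case
    by (simp add: seq_prefix_Suc_blocks run_prob_append del: mult_Suc)
qed

section \<open>Entropy bounds from a successful gale\<close>

context
  fixes k :: nat and G :: "'q gambler"
  assumes G: "multi_bet_gambler k G"
begin

lemma foldl_trans_in_states: "q \<in> states G \<Longrightarrow> foldl (trans G) q u \<in> states G"
  by (induction u arbitrary: q) (use G in \<open>auto simp: multi_bet_gambler_def\<close>)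

lemma run_prob_bounds:
  "q \<in> states G \<Longrightarrow> i \<in> {1..k} \<Longrightarrow> 0 \<le> run_prob G i q u \<and> run_prob G i q u \<le> 1"
proof (induction u arbitrary: q)
  case (Cons b u)
  have "0 \<le> bet G q i" "bet G q i \<le> 1" "trans G q b \<in> states G"
    using G Cons.prems by (auto simp: multi_bet_gambler_def)
  then show ?case
    using Cons.IH[of "trans G q b"] Cons.prems by (auto intro!: mult_nonneg_nonneg mult_le_one)
qed simp

text \<open>The measure on a block depends on the state in which the block is entered, whereas
  \<open>sum_log_blocks_le\<close> takes a single weight function. The sum \<open>r\<close> of the
  measures over all states dominates each of them and has total mass \<open>card (states G)\<close>,
  which costs the logarithm of that number per block.\<close>

lemma log_run_prob_le:
  assumes "m > 0" "l \<ge> 1" "i \<in> {1..k}"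
    and pos: "run_prob G i (start G) (seq_prefix X (m * l)) > 0"
  shows "log 2 (run_prob G i (start G) (seq_prefix X (m * l))) \<le>
    real m * (log 2 (real (card (states G))) -
      real l * disjoint_block_entropy l (seq_prefix X (m * l)))"
proof -
  define r where "r u = (\<Sum>q\<in>states G. run_prob G i q u)" for u
  define q where "q j = foldl (trans G) (start G) (seq_prefix X (j * l))" for j
  have Q: "finite (states G)" "states G \<noteq> {}" "start G \<in> states G"
    using G by (auto simp: multi_bet_gambler_def)
  have q: "q j \<in> states G" for j
    using Q by (simp add: q_def foldl_trans_in_states)
  have nonneg: "run_prob G i p u \<ge> 0" if "p \<in> states G" for p u
    using run_prob_bounds[OF that] assms by blast
  have eq: "run_prob G i (start G) (seq_prefix X (m * l)) =
      (\<Prod>j<m. run_prob G i (q j) (block X l j))"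
    by (simp add: run_prob_blocks q_def)
  have "run_prob G i (q j) (block X l j) \<noteq> 0" if "j < m" for j
  proof
    assume "run_prob G i (q j) (block X l j) = 0"
    then have "(\<Prod>j<m. run_prob G i (q j) (block X l j)) = 0"
      using that by (intro prod_zero) auto
    then show False
      using pos unfolding eq by linarith
  qed
  then have pos_block: "run_prob G i (q j) (block X l j) > 0" if "j < m" for j
    using that nonneg[OF q] by (metis less_eq_real_def)
  have le_r: "run_prob G i (q j) u \<le> r u" for j u
    unfolding r_def using Q q nonneg by (intro member_le_sum) auto
  have "log 2 (run_prob G i (start G) (seq_prefix X (m * l))) =
      (\<Sum>j<m. log 2 (run_prob G i (q j) (block X l j)))"
    unfolding eq by (rule log_prod) (auto dest: pos_block)
  also have "\<dots> \<le> (\<Sum>j<m. log 2 (r (block X l j)))"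
    using pos_block le_r by (intro sum_mono log_mono) auto
  also have "\<dots> \<le> real m * (log 2 (real (card (states G))) -
      real l * disjoint_block_entropy l (seq_prefix X (m * l)))"
  proof (rule sum_log_blocks_le)
    show "(\<Sum>u | length u = l. r u) \<le> real (card (states G))"
      unfolding r_def by (subst sum.swap) (simp add: sum_run_prob)
    show "r u \<ge> 0" for u
      unfolding r_def using nonneg by (intro sum_nonneg)
    show "r (block X l j) > 0" if "j < m" for j
      using pos_block[OF that] le_r by (rule less_le_trans)
    show "real (card (states G)) > 0"
      using Q by (simp add: card_gt_0_iff)
  qed (use assms in auto)
  finally show ?thesis .
qed

text \<open>The logarithm of the gale is positive; bounding the share of each bettor by
  \<open>log_run_prob_le\<close> and solving for the entropy gives the claim. The last term comes
  from the incomplete final block and the initial capital, and vanishes as \<open>m\<close>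
  grows.\<close>

lemma entropy_le_of_gale_ge_1:
  assumes "product_gale k s G (seq_prefix X n) > 1" "l \<ge> 1" "n \<ge> l" "s \<ge> 0"
  defines "m \<equiv> n div l"
  shows "disjoint_block_entropy l (seq_prefix X (m * l)) \<le>
    s + log 2 (real (card (states G))) / real l +
    (s * real k * real l + log 2 (of_rat (capital G))) / (real k * real l) / real m"
proof -
  define R where "R i n = run_prob G i (start G) (seq_prefix X n)" for i n
  define c :: real where "c = of_rat (capital G)"
  define N where "N = log 2 (real (card (states G)))"
  define H where "H = disjoint_block_entropy l (seq_prefix X (m * l))"
  have k: "k \<ge> 1" and start: "start G \<in> states G" and c0: "c \<ge> 0"
    using G by (auto simp: multi_bet_gambler_def c_def)
  have m: "m > 0" "m * l \<le> n" "n \<le> m * l + l"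
    using assms div_mult_mod_eq[of n l] mod_less_divisor[of l n]
    unfolding m_def by (auto simp: div_greater_zero_iff simp del: mod_less_divisor, linarith)
  have len: "length (seq_prefix X n) = n"
    by (simp add: seq_prefix_def)
  have gale: "product_gale k s G (seq_prefix X n) =
      c * 2 powr (s * real k * real n) * (\<Prod>i\<in>{1..k}. R i n)"
    by (simp add: product_gale_eq len R_def c_def)
  \<comment> \<open>Symbols after the last complete block can only lower the probability, so an
    upper bound at \<open>m * l\<close> holds at \<open>n\<close> too.\<close>
  have R: "0 \<le> R i n" "R i n \<le> R i (m * l)" if "i \<in> {1..k}" for i
  proof -
    show "0 \<le> R i n"
      using run_prob_bounds[OF start that] by (simp add: R_def)
    have "n = m * l + (n - m * l)"
      using m by simp
    then obtain v where "seq_prefix X n = seq_prefix X (m * l) @ v"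
      by (metis seq_prefix_add)
    then show "R i n \<le> R i (m * l)"
      using run_prob_bounds[OF start that] run_prob_bounds[OF foldl_trans_in_states[OF start] that]
      by (simp add: R_def run_prob_append mult_left_le)
  qed
  \<comment> \<open>No factor of a gale above 1 vanishes, so no logarithm below takes its default
    value at 0.\<close>
  have nz: "c \<noteq> 0" "(\<Prod>i\<in>{1..k}. R i n) \<noteq> 0"
    using assms(1) gale by (metis mult_zero_left mult_zero_right not_one_less_zero)+
  have pos: "c > 0" "\<And>i. i \<in> {1..k} \<Longrightarrow> R i n > 0"
  proof -
    show "c > 0"
      using c0 nz by simp
    show "R i n > 0" if "i \<in> {1..k}" for i
      using nz(2) R(1)[OF that] that by (metis finite_atLeastAtMost order_le_less prod_zero)
  qed
  then have pos': "R i (m * l) > 0" if "i \<in> {1..k}" for i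
    using R(2)[OF that] that by (meson less_le_trans)
  have "0 < log 2 (c * 2 powr (s * real k * real n) * (\<Prod>i\<in>{1..k}. R i n))"
    using assms(1) unfolding gale by simp
  also have "\<dots> = log 2 c + s * real k * real n + (\<Sum>i\<in>{1..k}. log 2 (R i n))"
  proof -
    have "log 2 (\<Prod>i\<in>{1..k}. R i n) = (\<Sum>i\<in>{1..k}. log 2 (R i n))"
      by (rule log_prod) (metis finite_atLeastAtMost, metis less_irrefl pos(2))
    then show ?thesis
      using pos(1) nz(2) by (simp add: log_mult del: prod_zero_iff)
  qed
  also have "\<dots> \<le> log 2 c + s * real k * real (m * l + l) + (\<Sum>i\<in>{1..k}. real m * (N - real l * H))"
  proof (intro add_mono sum_mono order_refl mult_left_mono)
    show "real n \<le> real (m * l + l)"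
      using m by linarith
    fix i assume i: "i \<in> {1..k}"
    have "log 2 (R i n) \<le> log 2 (R i (m * l))"
      using R(2)[OF i] pos(2)[OF i] by simp
    also have "\<dots> \<le> real m * (N - real l * H)"
      using log_run_prob_le[OF m(1) assms(2) i] pos'[OF i] by (simp add: R_def N_def H_def)
    finally show "log 2 (R i n) \<le> real m * (N - real l * H)" .
  qed (use assms in auto)
  finally have "real k * real m * real l * H \<le>
      log 2 c + s * real k * real l + real k * real m * (s * real l + N)"
    by (simp add: algebra_simps)
  then have "H \<le> (log 2 c + s * real k * real l + real k * real m * (s * real l + N)) /
      (real k * real m * real l)"
    using k m assms by (subst pos_le_divide_eq) (auto simp: mult_ac)
  also have "\<dots> = s + N / real l + (s * real k * real l + log 2 c) / (real k * real l) / real m"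
    using k m assms by (simp add: field_simps)
  finally show ?thesis
    by (simp add: H_def N_def c_def)
qed

text \<open>Success makes the gale exceed 1 on arbitrarily long prefixes, hence with arbitrarily
  many complete blocks, and the term \<open>B / real m\<close> disappears in the lower
  limit.\<close>

lemma disjoint_entropy_rate_at_le_of_succeeds:
  assumes succ: "gale_succeeds k s G X" and "l \<ge> 1" "s \<ge> 0"
  shows "disjoint_entropy_rate_at l X \<le> ereal (s + log 2 (real (card (states G))) / real l)"
proof -
  define A where "A = s + log 2 (real (card (states G))) / real l"
  define B where "B = (s * real k * real l + log 2 (of_rat (capital G))) / (real k * real l)"
  have "\<exists>\<^sub>F m in sequentially. ereal (disjoint_block_entropy l (seq_prefix X (m * l))) < y"
    if y: "y > ereal A" for y
  proof -
    obtain e where e: "A < e" "ereal e < y"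
      using ereal_dense2[OF y] by auto
    have "(\<lambda>m. A + B / real m) \<longlonglongrightarrow> A + 0"
      by (intro tendsto_intros lim_const_over_n)
    then have "\<forall>\<^sub>F m in sequentially. A + B / real m < e"
      using e by (intro order_tendstoD) auto
    then obtain M where M: "\<And>m. m \<ge> M \<Longrightarrow> A + B / real m < e"
      by (auto simp: eventually_sequentially)
    have "limsup (\<lambda>n. ereal (product_gale k s G (seq_prefix X n))) = \<infinity>"
      using succ by (simp add: gale_succeeds_def)
    then have freq: "\<exists>\<^sub>F n in sequentially. ereal 1 < ereal (product_gale k s G (seq_prefix X n))"
      by (intro frequently_greater_of_less_Limsup) simp
    have "\<exists>m\<ge>m0. ereal (disjoint_block_entropy l (seq_prefix X (m * l))) < y" for m0
    proof -
      \<comment> \<open>Each \<open>Suc\<close> ensures at least one complete block, so that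
        \<open>n \<ge> l\<close>; the maximum puts \<open>m\<close> beyond both \<open>m0\<close>
        and \<open>M\<close>.\<close>
      obtain n where n: "n \<ge> max (Suc m0) (Suc M) * l" "1 < product_gale k s G (seq_prefix X n)"
        using freq unfolding frequently_sequentially by (metis less_ereal.simps(1))
      define m where "m = n div l"
      have m: "m \<ge> max (Suc m0) (Suc M)"
        using div_le_mono[OF n(1), of l] \<open>l \<ge> 1\<close> by (simp add: m_def)
      have "l \<le> max (Suc m0) (Suc M) * l"
        by simp
      then have "n \<ge> l"
        using n(1) by (rule order_trans)
      then have "disjoint_block_entropy l (seq_prefix X (m * l)) \<le> A + B / real m"
        using entropy_le_of_gale_ge_1[OF n(2) \<open>l \<ge> 1\<close> _ \<open>s \<ge> 0\<close>] by (simp add: m_def A_def B_def)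
      also have "\<dots> < e"
        using m by (intro M) simp
      finally show ?thesis
        using e m by (intro exI[of _ m]) (auto intro: less_trans[of _ "ereal e"])
    qed
    then show ?thesis
      unfolding frequently_sequentially by blast
  qed
  then show ?thesis
    unfolding disjoint_entropy_rate_at_def A_def by (rule Liminf_le_of_frequently)
qed

text \<open>The number of states is fixed while the infimum leaves \<open>l\<close> free, so the
  error \<open>N / real l\<close> tends to 0.\<close>

lemma disjoint_entropy_rate_le_of_succeeds:
  assumes "gale_succeeds k s G X" "s \<ge> 0"
  shows "disjoint_entropy_rate X \<le> ereal s"
proof -
  define N where "N = log 2 (real (card (states G)))"
  have "disjoint_entropy_rate X \<le> ereal (s + N / real l)" if "l \<ge> 1" for l
    using INF_lower[of l "{1..}" "\<lambda>l. disjoint_entropy_rate_at l X"] that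
      disjoint_entropy_rate_at_le_of_succeeds[OF assms(1) that assms(2)]
    unfolding disjoint_entropy_rate_def N_def by (auto intro: order_trans)
  moreover have "(\<lambda>l. ereal (s + N / real l)) \<longlonglongrightarrow> ereal (s + 0)"
    by (intro tendsto_intros lim_const_over_n)
  ultimately show ?thesis
    using LIMSEQ_le_const[of "\<lambda>l. ereal (s + N / real l)" "ereal (s + 0)"] by (metis add_0_right)
qed

end

section \<open>Betting on blocks\<close>

text \<open>The unnormalised probability of the cylinder of \<open>q\<close>, that is, the total
  weight of the blocks of length \<open>l\<close> with prefix \<open>q\<close>; for
  \<open>length q = l\<close> it is \<open>w q\<close>.\<close>

definition cylinder_weight :: "nat \<Rightarrow> (bool list \<Rightarrow> nat) \<Rightarrow> bool list \<Rightarrow> nat" where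
  "cylinder_weight l w q = (\<Sum>v | length v = l - length q. w (q @ v))"

text \<open>The state is the part of the current block read so far, and the bet is the conditional
  probability of \<open>True\<close> given that part. Weights in the natural numbers keep the bets
  rational.\<close>

definition block_gambler :: "nat \<Rightarrow> (bool list \<Rightarrow> nat) \<Rightarrow> bool list gambler" where
  "block_gambler l w =
    \<lparr>states = {q. length q < l},
     trans = (\<lambda>q b. if Suc (length q) = l then [] else q @ [b]),
     bet = (\<lambda>q i. of_nat (cylinder_weight l w (q @ [True])) / of_nat (cylinder_weight l w q)),
     start = [], capital = 1\<rparr>"

context
  fixes l :: nat and w :: "bool list \<Rightarrow> nat"
  assumes l: "l \<ge> 1" and w: "\<And>u. w u > 0"
begin

lemma cylinder_weight_pos: "cylinder_weight l w q > 0"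
  unfolding cylinder_weight_def by (intro sum_length_pos w)

lemma cylinder_weight_split:
  assumes "length q < l"
  shows "cylinder_weight l w q = cylinder_weight l w (q @ [True]) + cylinder_weight l w (q @ [False])"
proof -
  have "l - length q = Suc (l - Suc (length q))"
    using assms by simp
  then show ?thesis
    by (simp add: cylinder_weight_def sum_length_Suc sum.distrib)
qed

lemma multi_bet_block_gambler: "multi_bet_gambler 1 (block_gambler l w)"
proof -
  have "{q :: bool list. length q < l} = (\<Union>n<l. {q. length q = n})"
    by auto
  then have "finite {q :: bool list. length q < l}"
    by (simp add: finite_length_eq)
  moreover have "(of_nat (cylinder_weight l w (q @ [True])) / of_nat (cylinder_weight l w q) :: rat) \<le> 1"
    if "length q < l" for q
    using cylinder_weight_split[OF that] cylinder_weight_pos[of q]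
    by (simp add: divide_le_eq_1_pos del: of_nat_add)
  ultimately show ?thesis
    using l by (auto simp: multi_bet_gambler_def block_gambler_def intro: exI[of _ "[]"])
qed

text \<open>The conditional probabilities along a block telescope.\<close>

lemma run_prob_block_gambler:
  "length q + length v \<le> l \<Longrightarrow>
    run_prob (block_gambler l w) i q v =
      real (cylinder_weight l w (q @ v)) / real (cylinder_weight l w q)"
proof (induction v arbitrary: q)
  case Nil
  then show ?case
    using cylinder_weight_pos[of q] by simp
next
  case (Cons b v)
  let ?G = "block_gambler l w"
  have pos: "cylinder_weight l w q > 0" "cylinder_weight l w (q @ [b]) > 0"
    by (rule cylinder_weight_pos)+
  have "run_prob ?G i (trans ?G q b) v =
      real (cylinder_weight l w (q @ b # v)) / real (cylinder_weight l w (q @ [b]))"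
  proof (cases "Suc (length q) = l")
    \<comment> \<open>The transition resets the state to \<open>[]\<close> here, but the length
      bound leaves nothing more to read.\<close>
    case True
    then have "v = []"
      using Cons.prems by (cases v) auto
    then show ?thesis
      using pos by simp
  next
    case False
    then show ?thesis
      using Cons.IH[of "q @ [b]"] Cons.prems by (simp add: block_gambler_def)
  qed
  moreover have "(if b then of_rat (bet ?G q i) else 1 - of_rat (bet ?G q i)) =
      real (cylinder_weight l w (q @ [b])) / real (cylinder_weight l w q)"
  proof -
    have "real (cylinder_weight l w q) =
        real (cylinder_weight l w (q @ [True])) + real (cylinder_weight l w (q @ [False]))"
      using cylinder_weight_split[of q] Cons.prems by simp
    moreover have "of_rat (bet ?G q i) =
        real (cylinder_weight l w (q @ [True])) / real (cylinder_weight l w q)"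
      by (simp add: block_gambler_def of_rat_divide)
    ultimately show ?thesis
      using pos(1) by (cases b) (simp_all add: diff_divide_eq_iff)
  qed
  ultimately show ?case
    using pos by simp
qed

lemma foldl_block_gambler:
  "v \<noteq> [] \<Longrightarrow> length q + length v = l \<Longrightarrow> foldl (trans (block_gambler l w)) q v = []"
proof (induction v arbitrary: q)
  case (Cons b v)
  show ?case
  proof (cases "v = []")
    case True
    then show ?thesis
      using Cons.prems by (simp add: block_gambler_def)
  next
    case False
    then show ?thesis
      using Cons.IH[of "q @ [b]"] Cons.prems by (cases v) (auto simp: block_gambler_def)
  qed
qed simp

text \<open>Every block is entered in the state \<open>[]\<close>, so the bets on it multiply to its
  probability under the normalised weights.\<close>

lemma product_gale_block_gambler:
  "product_gale 1 s (block_gambler l w) (seq_prefix X (k * l)) =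
    2 powr (s * real (k * l)) *
    (\<Prod>j<k. real (w (block X l j)) / real (\<Sum>u | length u = l. w u))"
proof -
  let ?G = "block_gambler l w"
  have "foldl (trans ?G) [] (seq_prefix X (j * l)) = []" for j
  proof (induction j)
    case 0
    then show ?case
      by (simp add: seq_prefix_def)
  next
    case (Suc j)
    have "block X l j \<noteq> []"
      using l by (metis length_block list.size(3) not_one_le_zero)
    with Suc show ?case
      by (simp add: seq_prefix_Suc_blocks foldl_block_gambler del: mult_Suc)
  qed
  moreover have "start ?G = []" "capital ?G = 1"
    by (simp_all add: block_gambler_def)
  moreover have "run_prob ?G 1 [] (block X l j) =
      real (w (block X l j)) / real (\<Sum>u | length u = l. w u)" for j
    by (simp add: run_prob_block_gambler cylinder_weight_def)
  moreover have "length (seq_prefix X (k * l)) = k * l"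
    by (simp add: seq_prefix_def)
  ultimately show ?thesis
    by (simp add: product_gale_eq run_prob_blocks)
qed

end

section \<open>Rounding the empirical block distribution\<close>

text \<open>
  Adding 1 to the rounded frequencies keeps the weights positive and makes the distribution
  that they define at least \<open>M / (M + 2\<^sup>l)\<close> times the empirical one.
\<close>

definition grid_weight :: "nat \<Rightarrow> (nat \<Rightarrow> bool) \<Rightarrow> nat \<Rightarrow> nat \<Rightarrow> bool list \<Rightarrow> nat" where
  "grid_weight M X l k u = (if length u = l then nat \<lfloor>real M * freq X l k u\<rfloor> + 1 else 1)"

lemma grid_weight_pos: "grid_weight M X l k u > 0"
  by (simp add: grid_weight_def)

text \<open>The weights are bounded by \<open>M + 1\<close> on the finitely many blocks of length
  \<open>l\<close> and equal 1 elsewhere, whatever \<open>k\<close> is. The pigeonhole choice of a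
  single gambler rests on this.\<close>

lemma finite_grid_weights: "finite (grid_weight M X l ` {0<..})"
proof (rule finite_subset)
  let ?F = "{f. \<forall>u :: bool list. (u \<in> {u. length u = l} \<longrightarrow> f u \<in> {..M + 1}) \<and>
    (u \<notin> {u. length u = l} \<longrightarrow> f u = (1 :: nat))}"
  have "nat \<lfloor>real M * freq X l k u\<rfloor> \<le> M" if "k > 0" for k u
  proof -
    have "real M * freq X l k u \<le> real M * 1"
      using that by (intro mult_left_mono freq_le_1) auto
    then show ?thesis
      by linarith
  qed
  then show "grid_weight M X l ` {0<..} \<subseteq> ?F"
    by (auto simp: grid_weight_def)
  show "finite ?F"
    by (intro finite_set_of_finite_funs finite_length_eq) auto
qed

text \<open>A near-converse of Gibbs' inequality: \<open>p\<close> is at least the empirical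
  frequency divided by \<open>C\<close>, so using it loses at most \<open>log 2 C\<close> per block
  against the entropy.\<close>

lemma sum_log_grid_weight_ge:
  fixes X :: "nat \<Rightarrow> bool"
  assumes "k > 0" "l \<ge> 1" "M > 0"
  defines "p \<equiv> \<lambda>u. real (grid_weight M X l k u) / real (\<Sum>u | length u = l. grid_weight M X l k u)"
  shows "(\<Sum>j<k. log 2 (p (block X l j))) \<ge>
    - real k * (real l * disjoint_block_entropy l (seq_prefix X (k * l)) + log 2 (1 + 2 ^ l / real M))"
proof -
  define C where "C = 1 + 2 ^ l / real M"
  define S where "S = real (\<Sum>u | length u = l. grid_weight M X l k u)"
  have C: "C > 0"
    by (simp add: C_def add_pos_nonneg)
  \<comment> \<open>Rounding down does not increase the total, so it is at most \<open>M\<close>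
    plus 1 for each of the \<open>2 ^ l\<close> blocks.\<close>
  have "S \<le> (\<Sum>u | length u = l. real M * freq X l k u + 1)"
    unfolding S_def of_nat_sum
    by (intro sum_mono) (auto simp: grid_weight_def freq_nonneg)
  also have "\<dots> = real M * C"
    using assms by (simp add: sum.distrib sum_freq card_length_eq C_def field_simps
        flip: sum_distrib_left)
  finally have S: "S \<le> real M * C" .
  have "S > 0"
    unfolding S_def by (simp only: of_nat_0_less_iff sum_length_pos grid_weight_pos)
  have "freq X l k u * log 2 (p u) \<ge> freq X l k u * (log 2 (freq X l k u) - log 2 C)"
    if "length u = l" for u
  proof (cases "freq X l k u = 0")
    case False
    then have f: "freq X l k u > 0"
      using freq_nonneg[of X l k u] by linarith
    have "freq X l k u / C = real M * freq X l k u / (real M * C)"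
      using assms by simp
    \<comment> \<open>The added 1 makes up for the rounding in the numerator.\<close>
    also have "\<dots> \<le> real (grid_weight M X l k u) / S"
      using f S \<open>S > 0\<close> that by (intro frac_le) (auto simp: grid_weight_def, linarith)
    finally have "freq X l k u / C \<le> p u"
      by (simp add: p_def S_def)
    then have "log 2 (freq X l k u / C) \<le> log 2 (p u)"
      using f C by (subst log_le_cancel_iff) (auto intro: less_le_trans[of _ "freq X l k u / C"])
    then show ?thesis
      using f C by (simp add: log_divide_pos)
  qed simp
  then have "(\<Sum>u | length u = l. freq X l k u * (log 2 (freq X l k u) - log 2 C)) \<le>
      (\<Sum>u | length u = l. freq X l k u * log 2 (p u))"
    by (intro sum_mono) simp
  moreover have "(\<Sum>u | length u = l. freq X l k u * (log 2 (freq X l k u) - log 2 C)) =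
      - (real l * disjoint_block_entropy l (seq_prefix X (k * l)) + log 2 C)"
    using assms by (simp add: right_diff_distrib sum_subtractf sum_freq
        disjoint_block_entropy_seq_prefix flip: sum_distrib_right)
  ultimately have "real k * - (real l * disjoint_block_entropy l (seq_prefix X (k * l)) + log 2 C) \<le>
      real k * (\<Sum>u | length u = l. freq X l k u * log 2 (p u))"
    by (intro mult_left_mono) auto
  then show ?thesis
    unfolding sum_blocks[OF \<open>k > 0\<close>, of "\<lambda>u. log 2 (p u)" X l] C_def
    by (simp only: mult_minus_left mult_minus_right)
qed

text \<open>The slack between the rate and \<open>s\<close> pays for the rounding. Along infinitely
  many \<open>k\<close> with entropy below \<open>t\<close> and the same rounded distribution, the
  gale of one gambler grows exponentially.\<close>

lemma succeeds_of_disjoint_entropy_rate_at_less: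
  assumes less: "disjoint_entropy_rate_at l X < ereal s" and l: "l \<ge> 1"
  shows "\<exists>G :: nat gambler. multi_bet_gambler 1 G \<and> gale_succeeds 1 s G X"
proof -
  obtain t where t: "disjoint_entropy_rate_at l X < ereal t" "t < s"
    using ereal_dense2[OF less] by auto
  define H where "H k = disjoint_block_entropy l (seq_prefix X (k * l))" for k
  have "\<exists>\<^sub>F k in sequentially. ereal (H k) < ereal t"
    using t unfolding disjoint_entropy_rate_at_def H_def
    by (intro frequently_less_of_Liminf_less) simp
  then have "\<exists>\<^sub>F k in sequentially. H k < t"
    by simp
  moreover have "\<forall>\<^sub>F k in sequentially. k > 0"
    by (rule eventually_gt_at_top)
  ultimately have "\<exists>\<^sub>F k in sequentially. k > 0 \<and> H k < t"
    by (rule frequently_eventually_conj)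
  then have inf: "infinite {k. H k < t \<and> k > 0}"
    by (simp add: frequently_cofinite conj_commute flip: cofinite_eq_sequentially)
  \<comment> \<open>The grid is chosen so fine that rounding costs less than the slack
    \<open>real l * (s - t)\<close> per block.\<close>
  have "(\<lambda>M. log 2 (1 + 2 ^ l / real M)) \<longlonglongrightarrow> log 2 (1 + 0)"
    by (intro tendsto_intros lim_const_over_n) auto
  then have "\<forall>\<^sub>F M in sequentially. log 2 (1 + 2 ^ l / real M) < real l * (s - t)"
    using l t by (intro order_tendstoD) auto
  then have "\<forall>\<^sub>F M in sequentially. M > 0 \<and> log 2 (1 + 2 ^ l / real M) < real l * (s - t)"
    by (intro eventually_conj eventually_gt_at_top)
  then obtain M where M: "M > 0" "log 2 (1 + 2 ^ l / real M) < real l * (s - t)"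
    by (auto dest!: eventually_happens)
  \<comment> \<open>The empirical distribution varies with \<open>k\<close>, but the gambler has to
    be fixed in advance: among finitely many rounded distributions, one recurs infinitely
    often.\<close>
  have "finite (grid_weight M X l ` {k. H k < t \<and> k > 0})"
    by (rule finite_subset[OF _ finite_grid_weights]) auto
  then obtain k0 where "infinite {k \<in> {k. H k < t \<and> k > 0}. grid_weight M X l k = grid_weight M X l k0}"
    using pigeonhole_infinite[OF inf] by blast
  moreover define w where "w = grid_weight M X l k0"
  ultimately have inf': "infinite {k. (H k < t \<and> k > 0) \<and> grid_weight M X l k = w}"
    by simp
  \<comment> \<open>The guaranteed gain per block, in bits.\<close>
  define e where "e = real l * (s - t) - log 2 (1 + 2 ^ l / real M)"
  have e: "e > 0"
    using M by (simp add: e_def)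
  let ?G = "block_gambler l w"
  have w: "w u > 0" for u
    by (simp add: w_def grid_weight_pos)
  have gale: "product_gale 1 s ?G (seq_prefix X (k * l)) \<ge> 2 powr (e * real k)"
    if k: "H k < t" "k > 0" "grid_weight M X l k = w" for k
  proof -
    define p where "p u = real (w u) / real (\<Sum>u | length u = l. w u)" for u
    have "(\<Sum>u | length u = l. w u) > 0"
      using w by (rule sum_length_pos)
    then have p: "p u > 0" for u
      using w[of u] by (simp add: p_def del: of_nat_sum)
    have "real l * H k \<le> real l * t"
      using k by (intro mult_left_mono) auto
    then have "real k * e \<le> real k * (s * real l - (real l * H k + log 2 (1 + 2 ^ l / real M)))"
      by (intro mult_left_mono) (auto simp: e_def algebra_simps)
    also have "\<dots> \<le> s * real (k * l) + (\<Sum>j<k. log 2 (p (block X l j)))"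
      using sum_log_grid_weight_ge[OF k(2) l M(1), of X]
      by (simp add: k(3) H_def p_def algebra_simps)
    finally have "2 powr (real k * e) \<le> 2 powr (s * real (k * l) + (\<Sum>j<k. log 2 (p (block X l j))))"
      by simp
    also have "\<dots> = 2 powr (s * real (k * l)) * (\<Prod>j<k. p (block X l j))"
      using p by (simp add: powr_add powr_sum)
    also have "\<dots> = product_gale 1 s ?G (seq_prefix X (k * l))"
      by (subst product_gale_block_gambler[OF l w]) (simp add: p_def)
    finally show ?thesis
      by (simp add: mult.commute)
  qed
  have "gale_succeeds 1 s ?G X"
    unfolding gale_succeeds_def
  proof (rule antisym)
    show "\<infinity> \<le> limsup (\<lambda>n. ereal (product_gale 1 s ?G (seq_prefix X n)))"
    proof (rule le_Limsup_of_frequently)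
      fix y :: ereal
      assume "y < \<infinity>"
      then obtain B where B: "y < ereal B"
        using ereal_dense2[of y \<infinity>] by auto
      have "filterlim (\<lambda>k. 2 powr (e * real k)) at_top sequentially"
        using e by real_asymp
      then have "\<forall>\<^sub>F k in sequentially. B \<le> 2 powr (e * real k)"
        by (simp add: filterlim_at_top)
      then obtain K where K: "\<And>k. k \<ge> K \<Longrightarrow> B \<le> 2 powr (e * real k)"
        by (auto simp: eventually_sequentially)
      show "\<exists>\<^sub>F n in sequentially. y < ereal (product_gale 1 s ?G (seq_prefix X n))"
        unfolding frequently_sequentially
      proof
        fix N
        obtain k where k: "k \<ge> max N K" "H k < t" "k > 0" "grid_weight M X l k = w"
          using inf' unfolding infinite_nat_iff_unbounded_le by blast
        have "k * 1 \<le> k * l"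
          using l by (intro mult_le_mono2)
        then have "N \<le> k * l"
          using k by linarith
        moreover have "ereal B \<le> ereal (product_gale 1 s ?G (seq_prefix X (k * l)))"
          using K[of k] gale[of k] k by (simp del: One_nat_def)
        ultimately show "\<exists>n\<ge>N. y < ereal (product_gale 1 s ?G (seq_prefix X n))"
          using B less_le_trans by blast
      qed
    qed
  qed simp
  \<comment> \<open>The states are lists, whereas \<open>multi_bet_rates\<close> ranges over
    gamblers with states in \<open>nat\<close>.\<close>
  moreover obtain G' :: "nat gambler" where "multi_bet_gambler 1 G'"
    and G': "\<And>s w. product_gale 1 s G' w = product_gale 1 s ?G w"
    using nat_states_suffice[OF multi_bet_block_gambler[of l w, OF l w]] by blast
  ultimately show ?thesis
    unfolding gale_succeeds_def G'[symmetric] by blast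
qed

section \<open>Entropy rate and dimension\<close>

lemma disjoint_entropy_rate_nonneg: "disjoint_entropy_rate X \<ge> 0"
proof -
  have "\<forall>\<^sub>F k in sequentially. 0 \<le> ereal (disjoint_block_entropy l (seq_prefix X (k * l)))"
    if "l \<ge> 1" for l
    using eventually_gt_at_top[of 0]
    by eventually_elim (use disjoint_block_entropy_nonneg[OF that] in simp)
  then show ?thesis
    unfolding disjoint_entropy_rate_def disjoint_entropy_rate_at_def
    by (intro INF_greatest Liminf_bounded) auto
qed

lemma disjoint_entropy_rate_le_1: "disjoint_entropy_rate X \<le> 1"
proof -
  have "\<forall>\<^sub>F k in sequentially. ereal (disjoint_block_entropy 1 (seq_prefix X (k * 1))) \<le> 1"
    using eventually_gt_at_top[of 0]
    by eventually_elim (use disjoint_block_entropy_le_1[of 1] in \<open>simp add: one_ereal_def\<close>)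
  then have "disjoint_entropy_rate_at 1 X \<le> 1"
    unfolding disjoint_entropy_rate_at_def
    by (intro order_trans[OF Liminf_le_Limsup Limsup_bounded]) auto
  moreover have "disjoint_entropy_rate X \<le> disjoint_entropy_rate_at 1 X"
    unfolding disjoint_entropy_rate_def by (rule INF_lower) simp
  ultimately show ?thesis
    by (rule order_trans[rotated])
qed

theorem theorem4:
  fixes X :: "nat \<Rightarrow> bool"
  shows "disjoint_entropy_rate X = ereal (multi_bet_dim X)"
proof -
  obtain h where h: "disjoint_entropy_rate X = ereal h" "0 \<le> h" "h \<le> 1"
    using disjoint_entropy_rate_nonneg[of X] disjoint_entropy_rate_le_1[of X]
    by (cases "disjoint_entropy_rate X") (auto simp: one_ereal_def)
  have lower: "h \<le> s" if "s \<in> multi_bet_rates X" for s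
    using that disjoint_entropy_rate_le_of_succeeds h by (fastforce simp: multi_bet_rates_def)
  have upper: "s \<in> multi_bet_rates X" if "h < s" "s \<le> 1" for s
  proof -
    have "disjoint_entropy_rate X < ereal s"
      using h that by simp
    then obtain l where "l \<ge> 1" "disjoint_entropy_rate_at l X < ereal s"
      unfolding disjoint_entropy_rate_def INF_less_iff by auto
    then show ?thesis
      using succeeds_of_disjoint_entropy_rate_at_less that h
      unfolding multi_bet_rates_def by force
  qed
  show ?thesis
  proof (cases "multi_bet_rates X = {}")
    case True
    \<comment> \<open>If \<open>h < 1\<close>, then \<open>upper\<close> would make 1 a rate; so
      \<open>h\<close> agrees with the default value 1 of the dimension.\<close>
    then have "h = 1"
      using upper[of 1] h by force
    then show ?thesis
      using True h by (simp add: multi_bet_dim_def)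
  next
    case False
    have "Inf (multi_bet_rates X) = h"
    proof (rule cInf_eq_non_empty[OF False lower])
      fix y
      assume y: "\<And>s. s \<in> multi_bet_rates X \<Longrightarrow> y \<le> s"
      show "y \<le> h"
      proof (cases "h = 1")
        \<comment> \<open>Here \<open>upper\<close> yields no rate, but the set is nonempty and each
          of its members is at most 1.\<close>
        case True
        then show ?thesis
          using False y by (force simp: multi_bet_rates_def)
      next
        case h1: False
        show ?thesis
        proof (rule dense_ge_bounded)
          show "h < 1"
            using h h1 by simp
          show "y \<le> s" if "h < s" "s < 1" for s
            using upper[of s] y that by simp
        qed
      qed
    qed
    then show ?thesis
      using False h by (simp add: multi_bet_dim_def)
  qed
qed

end
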